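(* Let $\mathring G=\{u\in\mathbb R^m:g_j(u)>0\ \forall j\in\mathcal J\}$ and $G=\overline{\mathring G}=\{u\in\mathbb R^m:g_j(u)\ge0\ \forall j\in\mathcal J\}$, where each $g_j$ is concave and $C^2$ on an open neighborhood of $G$. For $\mu>0$ define $$\Phi_\mu(u)=\tfrac12\|u\|_2^2-\mu\sum_{j\in\mathcal J}\log\bigl(g_j(u)\bigr),\qquad\Psi(u)=\nabla\Phi_\mu(u)=u-\mu\sum_{j\in\mathcal J}\frac{\nabla g_j(u)}{g_j(u)},\qquad u\in\mathring G.$$ Then: (i) $\Psi:\mathring G\to\mathbb R^m$ is bijective, and for each $w\in\mathbb R^m$, $\Psi^{-1}(w)$ is the unique minimizer over $u\in\mathring G$ of $\Phi_\mu(u)-w\cdot u$. (ii) $\Psi\in C^1(\mathring G)$ and $D\Psi(u)=\nabla^2\Phi_\mu(u)$ is symmetric positive definite for all $u\in\mathring G$; in particular $\Psi$ is a $C^1$ diffeomorphism. Furthermore $\|\Psi^{-1}(w_1)-\Psi^{-1}(w_2)\|_2\le\|w_1-w_2\|_2$ for all $w_1,w_2\in\mathbb R^m$. (iii) For any smooth solution $u(x,t)\in\mathring G$ of $\partial_tu+\sum_{i=1}^d\partial_{x_i}f_i(u)=0$, the variable $w=\Psi(u)$ satisfies $$\partial_tw+\sum_{i=1}^dJ_i(u)\,\partial_{x_i}w=0,\qquad J_i(u)=D\Psi(u)\,A_i(u)\,\bigl(D\Psi(u)\bigr)^{-1},\quad A_i(u)=Df_i(u).$$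
   Context: $\mathcal J$ is a finite index set, $\mathring G$ is nonempty and $G$ is convex. The fluxes $f_i$ are $C^1$ maps with values in $\mathbb R^m$. *)

theory Defs
  imports "HOL-Analysis.Analysis"
begin

(* Derivatives are taken in the full space, so these two notions are meant for open sets. *)
definition C1_on :: "('a::real_normed_vector \<Rightarrow> 'b::real_normed_vector) \<Rightarrow> 'a set \<Rightarrow> bool" where
  "C1_on f S \<longleftrightarrow>
     (\<exists>f' :: 'a \<Rightarrow> 'a \<Rightarrow>\<^sub>L 'b.
        (\<forall>x\<in>S. (f has_derivative blinfun_apply (f' x)) (at x)) \<and> continuous_on S f')"

definition C2_on :: "('a::real_normed_vector \<Rightarrow> 'b::real_normed_vector) \<Rightarrow> 'a set \<Rightarrow> bool" where
  "C2_on f S \<longleftrightarrow>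
     (\<exists>f' :: 'a \<Rightarrow> 'a \<Rightarrow>\<^sub>L 'b.
        (\<forall>x\<in>S. (f has_derivative blinfun_apply (f' x)) (at x)) \<and> C1_on f' S)"

definition C1_diffeomorphism ::
  "('a::real_normed_vector \<Rightarrow> 'b::real_normed_vector) \<Rightarrow> 'a set \<Rightarrow> 'b set \<Rightarrow> bool" where
  "C1_diffeomorphism f S T \<longleftrightarrow>
     open S \<and> open T \<and> bij_betw f S T \<and> C1_on f S \<and> C1_on (inv_into S f) T"

(* The library predicate concave_on forces the domain to be convex, whereas an open neighbourhood
   of a convex set need not contain a convex one.  Concavity on a possibly non-convex set means
   concavity on each of its convex subsets (equivalently, along each segment it contains). *)
definition concave_within :: "'a::real_vector set \<Rightarrow> ('a \<Rightarrow> real) \<Rightarrow> bool" where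
  "concave_within N f \<longleftrightarrow> (\<forall>S. convex S \<and> S \<subseteq> N \<longrightarrow> concave_on S f)"

lemma concave_within_iff_concave_on:
  assumes "convex N"
  shows "concave_within N f \<longleftrightarrow> concave_on N f"
  using assms unfolding concave_within_def concave_on_def by (meson convex_on_subset order_refl)

definition gradient :: "('a::real_inner \<Rightarrow> real) \<Rightarrow> 'a \<Rightarrow> 'a" where
  "gradient f x = (THE D. GDERIV f x :> D)"

lemma gradient_eqI:
  fixes f :: "'a::real_inner \<Rightarrow> real"
  assumes "GDERIV f x :> D"
  shows "gradient f x = D"
  unfolding gradient_def
proof (rule the_equality)
  fix E assume "GDERIV f x :> E"
  then have "(\<lambda>h. inner h E) = (\<lambda>h. inner h D)"
    using assms has_derivative_unique unfolding gderiv_def by blast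
  then show "E = D"
    by (metis vector_eq_ldot)
qed (fact assms)

definition partial_derivative ::
  "'n \<Rightarrow> (real ^ 'n \<Rightarrow> 'b::real_normed_vector) \<Rightarrow> real ^ 'n \<Rightarrow> 'b" where
  "partial_derivative i f x = vector_derivative (\<lambda>s. f (x + s *\<^sub>R axis i 1)) (at 0)"

definition hessian :: "(real ^ 'n \<Rightarrow> real) \<Rightarrow> real ^ 'n \<Rightarrow> real ^ 'n ^ 'n" where
  "hessian f x = (\<chi> i j. partial_derivative i (partial_derivative j f) x)"

definition symmetric_positive_definite :: "real ^ 'n ^ 'n \<Rightarrow> bool" where
  "symmetric_positive_definite A \<longleftrightarrow>
     transpose A = A \<and> (\<forall>v. v \<noteq> 0 \<longrightarrow> v \<bullet> (A *v v) > 0)"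

definition Phi :: "real \<Rightarrow> 'j set \<Rightarrow> ('j \<Rightarrow> real ^ 'm \<Rightarrow> real) \<Rightarrow> real ^ 'm \<Rightarrow> real" where
  "Phi \<mu> J g u = (1/2) * (norm u)\<^sup>2 - \<mu> * (\<Sum>j\<in>J. ln (g j u))"

definition Psi :: "real \<Rightarrow> 'j set \<Rightarrow> ('j \<Rightarrow> real ^ 'm \<Rightarrow> real) \<Rightarrow> real ^ 'm \<Rightarrow> real ^ 'm" where
  "Psi \<mu> J g = gradient (Phi \<mu> J g)"

(* Space-time functions take a pair (x, t), with the time variable last. *)
definition dt :: "('a \<times> real \<Rightarrow> 'b::real_normed_vector) \<Rightarrow> 'a \<Rightarrow> real \<Rightarrow> 'b" where
  "dt v x t = vector_derivative (\<lambda>s. v (x, s)) (at t)"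

definition dx ::
  "'d \<Rightarrow> ((real ^ 'd) \<times> real \<Rightarrow> 'b::real_normed_vector) \<Rightarrow> real ^ 'd \<Rightarrow> real \<Rightarrow> 'b" where
  "dx i v x t = partial_derivative i (\<lambda>y. v (y, t)) x"

end

theory Submission
  imports Defs
begin

text \<open>
  Everything about the map \<Psi> comes from one inequality, the strong convexity of the potential:
  \<open>\<Phi>(v) \<ge> \<Phi>(u) + \<Psi>(u) \<cdot> (v - u) + |v - u|\<^sup>2 / 2\<close> for u and v in the open set.
  The quadratic part of \<Phi> satisfies it with equality, and each \<open>- log g\<^sub>j\<close> lies above its tangent
  because \<open>log s \<le> s - 1\<close> and the concave \<open>g\<^sub>j\<close> lies below its own
  (\<open>Phi_strongly_convex\<close>).

  Adding the inequality to the one with u and v exchanged shows that \<Psi> is strongly monotone with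
  constant 1. So \<Psi> does not decrease distances, which gives injectivity and the Lipschitz bound for
  the inverse, and differentiating gives \<open>D\<Psi>(u) h \<cdot> h \<ge> |h|\<^sup>2\<close>; hence \<open>D\<Psi>(u)\<close> is
  invertible with an inverse of norm at most 1, and the inverse map is again of class C1
  (\<open>strongly_monotone_on_C1_diffeomorphism\<close>). Symmetry of \<open>D\<Psi>\<close> is symmetry of second
  derivatives (\<open>GDERIV_differentiable_imp_symmetric\<close>).

  For surjectivity, \<Psi> takes the value w exactly at the minimizers of \<open>\<Phi>(u) - w \<cdot> u\<close>: critical
  points are global minimizers by strong convexity. A minimizer exists because the barrier keeps the
  sublevel sets away from the boundary: such a set is bounded by the quadratic term, on a bounded
  set every \<open>g\<^sub>j\<close> is bounded above, so a bound on the sum of the \<open>- log g\<^sub>j\<close> bounds each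
  single \<open>g\<^sub>j\<close> away from 0 (\<open>tilted_Phi_attains_minimum\<close>).

  The transformed system is the chain rule: the derivatives of \<open>w = \<Psi>(u)\<close> are those of u multiplied
  by \<open>D\<Psi>(u)\<close>, so it is \<open>D\<Psi>(u)\<close> applied to the original one
  (\<open>conservation_law_change_of_variables\<close>).
\<close>

section \<open>Derivatives and functions of class C1\<close>

text \<open>In finite dimension the operator norm topology on derivatives is the topology of pointwise
  convergence, so it suffices to check continuity for each fixed direction, without packaging the
  derivative as a bounded linear function.\<close>

lemma C1_onI:
  fixes f :: "'a::euclidean_space \<Rightarrow> 'b::real_normed_vector"
  assumes "\<And>x. x \<in> S \<Longrightarrow> (f has_derivative f' x) (at x)"
    and "\<And>v. continuous_on S (\<lambda>x. f' x v)"
  shows "C1_on f S"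
  unfolding C1_on_def
proof (intro exI[of _ "\<lambda>x. Blinfun (f' x)"] conjI ballI)
  have app: "blinfun_apply (Blinfun (f' x)) = f' x" if "x \<in> S" for x
    using assms(1)[OF that] by (intro bounded_linear_Blinfun_apply has_derivative_bounded_linear)
  show "(f has_derivative blinfun_apply (Blinfun (f' x))) (at x)" if "x \<in> S" for x
    using assms(1) app that by simp
  show "continuous_on S (\<lambda>x. Blinfun (f' x))"
  proof (rule continuous_on_blinfun_componentwise)
    fix i :: 'a assume "i \<in> Basis"
    show "continuous_on S (\<lambda>x. blinfun_apply (Blinfun (f' x)) i)"
      using assms(2)[of i] app by (simp cong: continuous_on_cong)
  qed
qed

lemma C1_onE:
  assumes "C1_on f S"
  obtains f' where "\<And>x. x \<in> S \<Longrightarrow> (f has_derivative blinfun_apply (f' x)) (at x)"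
    and "continuous_on S f'"
  using assms unfolding C1_on_def by blast

lemma C1_on_imp_continuous_on: "C1_on f S \<Longrightarrow> continuous_on S f"
  unfolding C1_on_def
  by (meson continuous_at_imp_continuous_on has_derivative_continuous)

lemma C1_on_compose:
  fixes f :: "'a::euclidean_space \<Rightarrow> 'b::real_normed_vector"
  assumes "C1_on f S" and "C1_on h T" and "f ` S \<subseteq> T"
  shows "C1_on (\<lambda>x. h (f x)) S"
proof -
  obtain f' where f': "\<And>x. x \<in> S \<Longrightarrow> (f has_derivative blinfun_apply (f' x)) (at x)"
      "continuous_on S f'"
    using C1_onE[OF assms(1)] by blast
  obtain h' where h': "\<And>x. x \<in> T \<Longrightarrow> (h has_derivative blinfun_apply (h' x)) (at x)"
      "continuous_on T h'"
    using C1_onE[OF assms(2)] by blast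
  show ?thesis
  proof (rule C1_onI)
    show "((\<lambda>x. h (f x)) has_derivative (\<lambda>v. blinfun_apply (h' (f x)) (blinfun_apply (f' x) v)))
        (at x)" if "x \<in> S" for x
      using has_derivative_compose[OF f'(1)[OF that] h'(1)] assms(3) that by auto
    have "continuous_on S (\<lambda>x. h' (f x))"
      using continuous_on_compose2[OF h'(2) C1_on_imp_continuous_on[OF assms(1)] assms(3)] .
    then show "continuous_on S (\<lambda>x. blinfun_apply (h' (f x)) (blinfun_apply (f' x) v))" for v
      using f'(2) by (intro continuous_intros)
  qed
qed

lemma C2_on_GDERIV:
  fixes f :: "'a::euclidean_space \<Rightarrow> real"
  assumes "C2_on f N" and "x \<in> N"
  shows "GDERIV f x :> gradient f x"
proof -
  obtain f' :: "'a \<Rightarrow>\<^sub>L real" where "(f has_derivative blinfun_apply f') (at x)"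
    using assms unfolding C2_on_def by blast
  moreover have "blinfun_apply f' = (\<lambda>h. h \<bullet> (\<Sum>b\<in>Basis. f' b *\<^sub>R b))"
  proof
    fix h
    have "f' h = f' (\<Sum>b\<in>Basis. (h \<bullet> b) *\<^sub>R b)"
      by (simp add: euclidean_representation)
    then show "f' h = h \<bullet> (\<Sum>b\<in>Basis. f' b *\<^sub>R b)"
      by (simp add: blinfun.sum_right blinfun.scaleR_right inner_sum_right mult.commute)
  qed
  ultimately have "GDERIV f x :> (\<Sum>b\<in>Basis. f' b *\<^sub>R b)"
    unfolding gderiv_def by simp
  then show ?thesis
    using gradient_eqI by metis
qed

lemma C2_on_gradient_C1:
  fixes f :: "'a::euclidean_space \<Rightarrow> real"
  assumes "C2_on f N" and "open N"
  shows "C1_on (gradient f) N"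
proof -
  obtain f' :: "'a \<Rightarrow> 'a \<Rightarrow>\<^sub>L real" where
    f': "\<And>x. x \<in> N \<Longrightarrow> (f has_derivative blinfun_apply (f' x)) (at x)" "C1_on f' N"
    using assms unfolding C2_on_def by blast
  obtain f'' where f'': "\<And>x. x \<in> N \<Longrightarrow> (f' has_derivative blinfun_apply (f'' x)) (at x)"
      "continuous_on N f''"
    using C1_onE[OF f'(2)] by blast
  have grad: "gradient f x = (\<Sum>b\<in>Basis. f' x b *\<^sub>R b)" if "x \<in> N" for x
  proof -
    have "blinfun_apply (f' x) = (\<lambda>h. h \<bullet> gradient f x)"
      using f'(1)[OF that] C2_on_GDERIV[OF assms(1) that] has_derivative_unique
      unfolding gderiv_def by blast
    then show ?thesis
      by (metis (no_types, lifting) euclidean_representation inner_commute sum.cong)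
  qed
  show ?thesis
  proof (rule C1_onI)
    fix x assume x: "x \<in> N"
    have "((\<lambda>y. \<Sum>b\<in>Basis. f' y b *\<^sub>R b) has_derivative
        (\<lambda>v. \<Sum>b\<in>Basis. blinfun_apply (blinfun_apply (f'' x) v) b *\<^sub>R b)) (at x)"
      by (intro has_derivative_sum has_derivative_scaleR_left
          bounded_linear.has_derivative[OF blinfun.bounded_linear_left] f''(1) x)
    then show "(gradient f has_derivative
        (\<lambda>v. \<Sum>b\<in>Basis. blinfun_apply (blinfun_apply (f'' x) v) b *\<^sub>R b)) (at x)"
      by (rule has_derivative_transform_within_open[OF _ assms(2) x]) (simp add: grad)
  next
    show "continuous_on N (\<lambda>x. \<Sum>b\<in>Basis. blinfun_apply (blinfun_apply (f'' x) v) b *\<^sub>R b)" for v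
      using f''(2) by (intro continuous_intros)
  qed
qed

lemma partial_derivative_eq:
  fixes x :: "real ^ 'n"
  assumes "(f has_derivative f') (at x)"
  shows "partial_derivative i f x = f' (axis i 1)"
proof -
  have "((\<lambda>s. x + s *\<^sub>R axis i 1) has_derivative (\<lambda>s. s *\<^sub>R axis i 1)) (at (0::real))"
    by (auto intro!: derivative_eq_intros)
  then have "((\<lambda>s. f (x + s *\<^sub>R axis i 1)) has_derivative (\<lambda>s. f' (s *\<^sub>R axis i 1))) (at 0)"
    by (rule has_derivative_compose) (simp add: assms)
  moreover have "f' (s *\<^sub>R axis i 1) = s *\<^sub>R f' (axis i 1)" for s
    using assms by (simp add: has_derivative_linear linear_cmul)
  ultimately show ?thesis
    unfolding partial_derivative_def
    by (intro vector_derivative_at) (simp add: has_vector_derivative_def)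
qed

lemma dt_eq:
  assumes "(v has_derivative v') (at (x, t))"
  shows "dt v x t = v' (0, 1)"
proof -
  have "((\<lambda>s. (x, s)) has_derivative (\<lambda>s. (0, s))) (at t)"
    by (auto intro!: derivative_eq_intros)
  then have "((\<lambda>s. v (x, s)) has_derivative (\<lambda>s. v' (0, s))) (at t)"
    by (rule has_derivative_compose) (rule assms)
  moreover have "(\<lambda>s. v' (0, s)) = (\<lambda>s. s *\<^sub>R v' (0, 1))"
  proof
    show "v' (0, s) = s *\<^sub>R v' (0, 1)" for s
      unfolding linear_cmul[OF has_derivative_linear[OF assms], symmetric] by simp
  qed
  ultimately show ?thesis
    unfolding dt_def by (intro vector_derivative_at) (simp only: has_vector_derivative_def)
qed

lemma dx_eq:
  assumes "(v has_derivative v') (at (x, t))"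
  shows "dx i v x t = v' (axis i 1, 0)"
proof -
  have "((\<lambda>y. (y, t)) has_derivative (\<lambda>y. (y, 0))) (at x)"
    by (auto intro!: derivative_eq_intros)
  then have "((\<lambda>y. v (y, t)) has_derivative (\<lambda>y. v' (y, 0))) (at x)"
    by (rule has_derivative_compose) (rule assms)
  then show ?thesis
    unfolding dx_def by (rule partial_derivative_eq)
qed

lemma C1_on_differentiable: "C1_on f S \<Longrightarrow> x \<in> S \<Longrightarrow> f differentiable (at x)"
  by (metis C1_onE differentiableI)

text \<open>The second difference of f in the directions a and b with step h is \<open>h\<^sup>2 (F' b \<bullet> a)\<close> up to
  \<open>o(h\<^sup>2)\<close>: one application of the mean value theorem in direction a expresses it by a difference
  of gradients at points within \<open>O(h)\<close> of x, where differentiability of F at the single point x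
  applies. The second difference is symmetric in a and b, hence so is the limit.\<close>

lemma GDERIV_differentiable_imp_symmetric:
  fixes F :: "'a::real_inner \<Rightarrow> 'a"
  assumes "open S" and "x \<in> S"
    and grad: "\<And>y. y \<in> S \<Longrightarrow> GDERIV f y :> F y"
    and der: "(F has_derivative F') (at x)"
  shows "F' a \<bullet> b = F' b \<bullet> a"
proof -
  have lin: "linear F'"
    using der by (rule has_derivative_linear)
  define \<Delta> where "\<Delta> h a b = f (x + h *\<^sub>R a + h *\<^sub>R b) - f (x + h *\<^sub>R a) - f (x + h *\<^sub>R b) + f x" for h a b
  have sym: "\<Delta> h a b = \<Delta> h b a" for h a b
    by (simp add: \<Delta>_def algebra_simps)
  define M where "M = norm a + norm b"
  have M0: "M \<ge> 0" by (simp add: M_def)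
  obtain r where r: "r > 0" "ball x r \<subseteq> S"
    using assms(1,2) openE by blast
  have key: "\<exists>d>0. \<forall>h a' b'. 0 < h \<and> h * M < d \<and> norm a' + norm b' = M \<longrightarrow>
      \<bar>\<Delta> h a' b' - h\<^sup>2 * (F' b' \<bullet> a')\<bar> \<le> h\<^sup>2 * (2 * e * M\<^sup>2)" if e: "e > 0" for e :: real
  proof -
    obtain d0 where d0: "d0 > 0"
      "\<And>y. norm (y - x) < d0 \<Longrightarrow> norm (F y - F x - F' (y - x)) \<le> e * norm (y - x)"
      using der e unfolding has_derivative_at_alt by blast
    define d where "d = min d0 r"
    have "\<bar>\<Delta> h a' b' - h\<^sup>2 * (F' b' \<bullet> a')\<bar> \<le> h\<^sup>2 * (2 * e * M\<^sup>2)"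
      if h: "0 < h" "h * M < d" "norm a' + norm b' = M" for h a' b'
    proof -
      have bnd: "norm (s *\<^sub>R a' + c *\<^sub>R b') \<le> h * M" if "0 \<le> s" "s \<le> h" "0 \<le> c" "c \<le> h" for s c
      proof -
        have "norm (s *\<^sub>R a' + c *\<^sub>R b') \<le> s * norm a' + c * norm b'"
          using norm_triangle_ineq[of "s *\<^sub>R a'" "c *\<^sub>R b'"] that by simp
        also have "\<dots> \<le> h * norm a' + h * norm b'"
          using that by (intro add_mono mult_right_mono) auto
        finally show ?thesis using h(3) by (simp add: algebra_simps flip: h(3))
      qed
      have inS: "x + (s *\<^sub>R a' + c *\<^sub>R b') \<in> S" if "0 \<le> s" "s \<le> h" "0 \<le> c" "c \<le> h" for s c
      proof -
        have "norm (s *\<^sub>R a' + c *\<^sub>R b') < r"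
          using bnd[OF that] h(2) by (simp add: d_def)
        then have "x + (s *\<^sub>R a' + c *\<^sub>R b') \<in> ball x r"
          unfolding mem_ball dist_norm norm_minus_commute[of x] add_diff_cancel_left' .
        then show ?thesis
          using r(2) by (rule subsetD[rotated])
      qed
      \<comment> \<open>The second difference is the increment over [0, h] of a function of one variable.\<close>
      define \<phi> where "\<phi> s = f (x + (s *\<^sub>R a' + h *\<^sub>R b')) - f (x + (s *\<^sub>R a' + 0 *\<^sub>R b'))" for s
      define \<phi>' where "\<phi>' s t = (t *\<^sub>R a') \<bullet> (F (x + (s *\<^sub>R a' + h *\<^sub>R b')) - F (x + (s *\<^sub>R a' + 0 *\<^sub>R b')))"
        for s t
      have line: "((\<lambda>s. f (x + (s *\<^sub>R a' + c *\<^sub>R b'))) has_derivative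
          (\<lambda>t. (t *\<^sub>R a') \<bullet> F (x + (s *\<^sub>R a' + c *\<^sub>R b')))) (at s)"
        if "0 \<le> s" "s \<le> h" "0 \<le> c" "c \<le> h" for s c
      proof -
        have "((\<lambda>s. x + (s *\<^sub>R a' + c *\<^sub>R b')) has_derivative (\<lambda>t. t *\<^sub>R a')) (at s)"
          by (auto intro!: derivative_eq_intros)
        then show ?thesis
          by (rule has_derivative_compose) (use grad[OF inS[OF that]] in \<open>simp add: gderiv_def\<close>)
      qed
      have "(\<phi> has_derivative \<phi>' s) (at s within {0..h})" if "0 \<le> s" "s \<le> h" for s
      proof -
        have "(\<phi> has_derivative \<phi>' s) (at s)"
          unfolding \<phi>_def[abs_def] \<phi>'_def[abs_def] inner_diff_right
          by (rule has_derivative_diff[OF line[of s h] line[of s 0]]) (use that h(1) in simp_all)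
        then show ?thesis
          by (rule has_derivative_at_withinI)
      qed
      then obtain s where s: "0 < s" "s < h" "\<phi> h - \<phi> 0 = \<phi>' s (h - 0)"
        using mvt_simple[of 0 h \<phi> \<phi>'] h(1) by auto
      \<comment> \<open>Expand the gradients at both points around x; their linear parts differ by h F' b'.\<close>
      let ?y1 = "s *\<^sub>R a' + h *\<^sub>R b'" and ?y0 = "s *\<^sub>R a' + 0 *\<^sub>R b'"
      let ?R = "\<lambda>y. F (x + y) - F x - F' y"
      have R: "norm (?R (s *\<^sub>R a' + c *\<^sub>R b')) \<le> e * (h * M)" if "0 \<le> c" "c \<le> h" for c
      proof -
        have n: "norm (s *\<^sub>R a' + c *\<^sub>R b') \<le> h * M"
          using bnd that s by auto
        then have "norm (?R (s *\<^sub>R a' + c *\<^sub>R b')) \<le> e * norm (s *\<^sub>R a' + c *\<^sub>R b')"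
          using d0(2)[of "x + (s *\<^sub>R a' + c *\<^sub>R b')"] h(2) by (simp add: d_def)
        also have "\<dots> \<le> e * (h * M)"
          using n e by simp
        finally show ?thesis .
      qed
      have "F (x + ?y1) - F (x + ?y0) = h *\<^sub>R F' b' + (?R ?y1 - ?R ?y0)"
        using lin by (simp add: linear_add linear_cmul)
      moreover have "\<Delta> h a' b' = h * (a' \<bullet> (F (x + ?y1) - F (x + ?y0)))"
        using s(3) by (simp add: \<Delta>_def \<phi>_def \<phi>'_def algebra_simps)
      ultimately have "\<Delta> h a' b' - h\<^sup>2 * (F' b' \<bullet> a') = h * (a' \<bullet> (?R ?y1 - ?R ?y0))"
        by (simp only: inner_add_right inner_scaleR_right)
          (simp add: algebra_simps power2_eq_square inner_commute)
      also have "\<bar>\<dots>\<bar> \<le> h * (M * (e * (h * M) + e * (h * M)))"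
      proof -
        have "\<bar>a' \<bullet> (?R ?y1 - ?R ?y0)\<bar> \<le> norm a' * norm (?R ?y1 - ?R ?y0)"
          by (rule Cauchy_Schwarz_ineq2)
        also have "\<dots> \<le> M * (e * (h * M) + e * (h * M))"
        proof (intro mult_mono)
          show "norm (?R ?y1 - ?R ?y0) \<le> e * (h * M) + e * (h * M)"
            using norm_triangle_ineq4[of "?R ?y1" "?R ?y0"] R[of h] R[of 0] h(1) by linarith
          show "norm a' \<le> M"
            using h(3) norm_ge_zero[of b'] by linarith
        qed (use M0 in auto)
        finally show ?thesis
          using h(1) by (simp add: abs_mult)
      qed
      also have "\<dots> = h\<^sup>2 * (2 * e * M\<^sup>2)"
        by (simp add: power2_eq_square algebra_simps)
      finally show ?thesis .
    qed
    moreover have "d > 0"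
      using d0(1) r(1) by (simp add: d_def)
    ultimately show ?thesis by blast
  qed
  have bound: "\<bar>F' a \<bullet> b - F' b \<bullet> a\<bar> \<le> e * (4 * M\<^sup>2)" if e: "e > 0" for e
  proof -
    obtain d where d: "d > 0" "\<And>h a' b'. 0 < h \<and> h * M < d \<and> norm a' + norm b' = M \<Longrightarrow>
      \<bar>\<Delta> h a' b' - h\<^sup>2 * (F' b' \<bullet> a')\<bar> \<le> h\<^sup>2 * (2 * e * M\<^sup>2)"
      using key[OF e] by blast
    define h where "h = d / (M + 1)"
    have h: "0 < h" "h * M < d"
      using d(1) M0 by (auto simp: h_def field_simps)
    have "\<bar>\<Delta> h a b - h\<^sup>2 * (F' b \<bullet> a)\<bar> \<le> h\<^sup>2 * (2 * e * M\<^sup>2)"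
      "\<bar>\<Delta> h a b - h\<^sup>2 * (F' a \<bullet> b)\<bar> \<le> h\<^sup>2 * (2 * e * M\<^sup>2)"
      using d(2)[of h a b] d(2)[of h b a] h sym[of h a b] by (auto simp: M_def)
    then have "\<bar>h\<^sup>2 * (F' a \<bullet> b) - h\<^sup>2 * (F' b \<bullet> a)\<bar> \<le> h\<^sup>2 * (e * (4 * M\<^sup>2))"
      by (simp add: algebra_simps)
    then have "h\<^sup>2 * \<bar>F' a \<bullet> b - F' b \<bullet> a\<bar> \<le> h\<^sup>2 * (e * (4 * M\<^sup>2))"
      by (simp add: abs_mult flip: right_diff_distrib)
    then show ?thesis
      using h(1) by simp
  qed
  have "\<bar>F' a \<bullet> b - F' b \<bullet> a\<bar> \<le> 0 + e" if "e > 0" for e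
  proof -
    have pos: "4 * M\<^sup>2 + 1 > 0"
      by (simp add: add_nonneg_pos)
    then have "e / (4 * M\<^sup>2 + 1) * (4 * M\<^sup>2) \<le> e / (4 * M\<^sup>2 + 1) * (4 * M\<^sup>2 + 1)"
      using that by (intro mult_left_mono) auto
    then have "e / (4 * M\<^sup>2 + 1) * (4 * M\<^sup>2) \<le> e"
      using pos by simp
    moreover have "e / (4 * M\<^sup>2 + 1) > 0"
      using that pos by simp
    ultimately show ?thesis
      using bound[of "e / (4 * M\<^sup>2 + 1)"] by linarith
  qed
  then have "\<bar>F' a \<bullet> b - F' b \<bullet> a\<bar> \<le> 0"
    by (rule field_le_epsilon)
  then show ?thesis by simp
qed

section \<open>Strongly monotone maps\<close>

definition strongly_monotone_on :: "'a::real_inner set \<Rightarrow> ('a \<Rightarrow> 'a) \<Rightarrow> bool" where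
  "strongly_monotone_on S F \<longleftrightarrow> (\<forall>u\<in>S. \<forall>v\<in>S. (norm (u - v))\<^sup>2 \<le> (F u - F v) \<bullet> (u - v))"

lemma strongly_monotone_on_expanding:
  assumes "strongly_monotone_on S F" and "u \<in> S" and "v \<in> S"
  shows "norm (u - v) \<le> norm (F u - F v)"
proof -
  have "norm (u - v) * norm (u - v) \<le> norm (F u - F v) * norm (u - v)"
    using assms norm_cauchy_schwarz[of "F u - F v" "u - v"]
    unfolding strongly_monotone_on_def power2_eq_square by force
  then show ?thesis
    by (metis mult_right_le_imp_le norm_ge_zero order_le_less)
qed

lemma strongly_monotone_on_inj: "strongly_monotone_on S F \<Longrightarrow> inj_on F S"
  using strongly_monotone_on_expanding[of S F] by (fastforce intro!: inj_onI)

text \<open>The monotonicity inequality for the points x + s h and x, divided by \<open>s\<^sup>2\<close>, tends to the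
  claim as s tends to 0.\<close>

lemma strongly_monotone_on_derivative:
  assumes "strongly_monotone_on S F" and "open S" and "x \<in> S"
    and der: "(F has_derivative F') (at x)"
  shows "(norm h)\<^sup>2 \<le> F' h \<bullet> h"
proof -
  have lin: "linear F'"
    using der by (rule has_derivative_linear)
  have path: "((\<lambda>s. x + s *\<^sub>R h) has_derivative (\<lambda>s. s *\<^sub>R h)) (at (0::real))"
    by (auto intro!: derivative_eq_intros)
  have "((\<lambda>s. F (x + s *\<^sub>R h)) has_derivative (\<lambda>s. F' (s *\<^sub>R h))) (at 0)"
    using path by (rule has_derivative_compose) (simp add: der)
  then have "((\<lambda>s. F (x + s *\<^sub>R h) \<bullet> h) has_derivative (\<lambda>s. F' (s *\<^sub>R h) \<bullet> h)) (at 0)"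
    by (rule has_derivative_inner_left)
  then have "((\<lambda>s. F (x + s *\<^sub>R h) \<bullet> h) has_real_derivative F' h \<bullet> h) (at 0)"
    unfolding has_field_derivative_def using lin by (simp add: linear_cmul mult_commute_abs)
  then have lim: "((\<lambda>s. (F (x + s *\<^sub>R h) \<bullet> h - F x \<bullet> h) / s) \<longlongrightarrow> F' h \<bullet> h) (at 0)"
    by (simp add: DERIV_def)
  have "((\<lambda>s. x + s *\<^sub>R h) \<longlongrightarrow> x) (at (0::real))"
    using has_derivative_continuous[OF path] by (simp add: continuous_at isCont_def)
  then have "eventually (\<lambda>s. x + s *\<^sub>R h \<in> S) (at (0::real))"
    using assms(2,3) by (rule topological_tendstoD)
  then have "eventually (\<lambda>s. (norm h)\<^sup>2 \<le> (F (x + s *\<^sub>R h) \<bullet> h - F x \<bullet> h) / s) (at 0)"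
    using eventually_neq_at_within[of 0]
  proof eventually_elim
    case (elim s)
    have "(norm (s *\<^sub>R h))\<^sup>2 \<le> (F (x + s *\<^sub>R h) - F x) \<bullet> (s *\<^sub>R h)"
      using assms(1,3) elim(1) unfolding strongly_monotone_on_def by force
    then have "s\<^sup>2 * (norm h)\<^sup>2 \<le> s * (F (x + s *\<^sub>R h) \<bullet> h - F x \<bullet> h)"
      by (simp add: power_mult_distrib inner_diff_left)
    also have "\<dots> = s\<^sup>2 * ((F (x + s *\<^sub>R h) \<bullet> h - F x \<bullet> h) / s)"
      using elim(2) by (simp add: power2_eq_square)
    finally have "s\<^sup>2 * (norm h)\<^sup>2 \<le> \<dots>" .
    then show ?case
      by (rule mult_left_le_imp_le) (simp add: elim(2))
  qed
  then show ?thesis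
    by (rule tendsto_lowerbound[OF lim]) simp
qed

lemma strongly_monotone_on_inverse_nonexpansive:
  assumes "strongly_monotone_on S F" and "F ` S = T" and "y \<in> T" and "z \<in> T"
  shows "norm (inv_into S F y - inv_into S F z) \<le> norm (y - z)"
  using strongly_monotone_on_expanding[OF assms(1), of "inv_into S F y" "inv_into S F z"] assms(2-4)
  by (simp add: f_inv_into_f inv_into_into)

text \<open>Monotonicity makes each derivative expanding, hence invertible, and the inverse map Lipschitz, and a
  continuous inverse is differentiable wherever the derivative of F is invertible. Its derivatives \<open>B\<close> are contractions and depend continuously on the point by the
  resolvent identity \<open>B z - B y = B z (F' y - F' z) B y\<close>, the derivatives \<open>F'\<close> being taken at the
  preimages of y and z.\<close>

lemma strongly_monotone_on_C1_diffeomorphism: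
  fixes F :: "'a::euclidean_space \<Rightarrow> 'a"
  assumes mono: "strongly_monotone_on S F" and "open S" and "F ` S = T" and "open T"
    and "C1_on F S"
  shows "C1_diffeomorphism F S T"
proof -
  obtain F' where F': "\<And>x. x \<in> S \<Longrightarrow> (F has_derivative blinfun_apply (F' x)) (at x)"
      "continuous_on S F'"
    using C1_onE[OF assms(5)] by blast
  have inj: "inj_on F S"
    using mono by (rule strongly_monotone_on_inj)
  let ?G = "inv_into S F"
  have GS: "?G y \<in> S" "F (?G y) = y" if "y \<in> T" for y
    using that assms(3) by (auto simp: inv_into_into f_inv_into_f)
  have contG: "continuous_on T ?G"
  proof (rule continuous_onI)
    show "\<exists>d>0. \<forall>y'\<in>T. dist y' y < d \<longrightarrow> dist (?G y') (?G y) \<le> e" if "y \<in> T" "e > 0" for y e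
      using strongly_monotone_on_inverse_nonexpansive[OF mono assms(3) _ that(1)] that(2)
      by (intro exI[of _ e]) (force simp: dist_norm)
  qed
  have pos: "norm h \<le> norm (F' x h)" if "x \<in> S" for x h
  proof -
    have "norm h * norm h \<le> norm (F' x h) * norm h"
      using strongly_monotone_on_derivative[OF mono assms(2) that F'(1)[OF that], of h]
        norm_cauchy_schwarz[of "F' x h" h] by (simp add: power2_eq_square)
    then show ?thesis
      by (metis mult_right_le_imp_le norm_ge_zero order_le_less)
  qed
  define B where "B y = inv (blinfun_apply (F' (?G y)))" for y
  have lin: "linear (blinfun_apply (F' x))" for x
    by (simp add: blinfun.bounded_linear_right bounded_linear.linear)
  have injF: "inj (blinfun_apply (F' x))" if "x \<in> S" for x
    unfolding linear_injective_0[OF lin] using pos[OF that]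
    by (metis norm_le_zero_iff norm_zero)
  have surjF: "surj (blinfun_apply (F' x))" if "x \<in> S" for x
    using linear_injective_imp_surjective[OF lin] injF that by simp
  have B: "F' (?G y) (B y k) = k" "B y (F' (?G y) k) = k" if "y \<in> T" for y k
    using injF surjF GS(1)[OF that] by (simp_all add: B_def surj_f_inv_f)
  have Bn: "norm (B y k) \<le> norm k" if "y \<in> T" for y k
    using pos[OF GS(1)[OF that], of "B y k"] B(1)[OF that] by simp
  have "C1_on ?G T"
  proof (rule C1_onI)
    fix y assume y: "y \<in> T"
    show "(?G has_derivative B y) (at y)"
    proof (rule has_derivative_inverse_basic[where g = ?G and T = T,
            OF F'(1)[OF GS(1)[OF y]] _ _ _ assms(4) y])
      have "linear (B y)"
        using inj_linear_imp_inv_linear[OF lin injF] GS(1)[OF y] by (simp add: B_def)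
      then show "bounded_linear (B y)"
        by (simp add: linear_conv_bounded_linear)
      show "B y \<circ> blinfun_apply (F' (?G y)) = id"
        using B(2)[OF y] by auto
      show "continuous (at y) ?G"
        using contG assms(4) y by (simp add: continuous_on_eq_continuous_at)
      show "F (?G z) = z" if "z \<in> T" for z
        using GS(2) that .
    qed
  next
    fix k
    have contD: "continuous_on T (\<lambda>y. F' (?G y))"
      using continuous_on_compose2[OF F'(2) contG] GS(1) by blast
    show "continuous_on T (\<lambda>y. B y k)"
      unfolding continuous_on
    proof
      fix y assume y: "y \<in> T"
      have "((\<lambda>z. F' (?G z)) \<longlongrightarrow> F' (?G y)) (at y within T)"
        using contD y by (simp add: continuous_on)
      then have lim: "((\<lambda>z. norm (F' (?G y) - F' (?G z)) * norm (B y k)) \<longlongrightarrow> 0) (at y within T)"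
        by (auto intro!: tendsto_eq_intros)
      have "norm (B z k - B y k) \<le> norm (F' (?G y) - F' (?G z)) * norm (B y k)" if z: "z \<in> T" for z
      proof -
        \<comment> \<open>The resolvent identity with the leftmost factor B z, a contraction, moved to the other side.\<close>
        have "norm (B z k - B y k) \<le> norm (F' (?G z) (B z k - B y k))"
          using pos GS(1) z by blast
        also have "F' (?G z) (B z k - B y k) = (F' (?G y) - F' (?G z)) (B y k)"
          using B(1)[OF y] B(1)[OF z] by (simp add: blinfun.diff_right blinfun.diff_left)
        also have "norm \<dots> \<le> norm (F' (?G y) - F' (?G z)) * norm (B y k)"
          by (rule norm_blinfun)
        finally show ?thesis .
      qed
      then have "((\<lambda>z. B z k - B y k) \<longlongrightarrow> 0) (at y within T)"
        by (intro Lim_null_comparison[OF _ lim]) (simp add: eventually_at_filter)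
      then show "((\<lambda>z. B z k) \<longlongrightarrow> B y k) (at y within T)"
        by (simp add: Lim_null[symmetric] LIM_zero_iff)
    qed
  qed
  then show ?thesis
    using assms inj by (simp add: C1_diffeomorphism_def bij_betw_def)
qed

section \<open>Log-barrier potential\<close>

lemma concave_on_tangent:
  assumes "concave_on S f" and "x \<in> S" and "y \<in> S" and "GDERIV f x :> D"
  shows "f y \<le> f x + D \<bullet> (y - x)"
proof -
  have "((\<lambda>s. x + s *\<^sub>R (y - x)) has_derivative (\<lambda>s. s *\<^sub>R (y - x))) (at (0::real))"
    by (auto intro!: derivative_eq_intros)
  then have "((\<lambda>s. f (x + s *\<^sub>R (y - x))) has_derivative (\<lambda>s. (s *\<^sub>R (y - x)) \<bullet> D)) (at 0)"
    by (rule has_derivative_compose) (use assms(4) in \<open>simp add: gderiv_def\<close>)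
  then have "((\<lambda>s. f (x + s *\<^sub>R (y - x))) has_real_derivative D \<bullet> (y - x)) (at 0)"
    unfolding has_field_derivative_def by (simp add: inner_commute mult_commute_abs)
  then have "((\<lambda>s. (f (x + s *\<^sub>R (y - x)) - f x) / s) \<longlongrightarrow> D \<bullet> (y - x)) (at 0)"
    by (simp add: DERIV_def)
  then have lim: "((\<lambda>s. (f (x + s *\<^sub>R (y - x)) - f x) / s) \<longlongrightarrow> D \<bullet> (y - x)) (at_right 0)"
    by (rule filterlim_mono) (auto simp: at_within_le_at)
  have "eventually (\<lambda>s. s \<in> {0<..<(1::real)}) (at_right 0)"
    by (rule eventually_at_right_real) simp
  then have "eventually (\<lambda>s. f y - f x \<le> (f (x + s *\<^sub>R (y - x)) - f x) / s) (at_right 0)"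
  proof eventually_elim
    case (elim s)
    have "(1 - s) * f x + s * f y \<le> f ((1 - s) *\<^sub>R x + s *\<^sub>R y)"
      using assms(1-3) elim by (intro concave_onD) auto
    also have "(1 - s) *\<^sub>R x + s *\<^sub>R y = x + s *\<^sub>R (y - x)"
      by (simp add: algebra_simps)
    finally show ?case
      using elim by (simp add: field_simps)
  qed
  then have "f y - f x \<le> D \<bullet> (y - x)"
    by (rule tendsto_lowerbound[OF lim]) simp
  then show ?thesis by simp
qed

locale log_barrier =
  fixes J :: "'j set"
    and g :: "'j \<Rightarrow> real ^ 'm \<Rightarrow> real"
    and Gint G :: "(real ^ 'm) set"
    and \<mu> :: real
  assumes finite_J: "finite J"
    and Gint_eq: "Gint = {u. \<forall>j\<in>J. g j u > 0}"
    and G_closure: "G = closure Gint"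
    and G_eq: "G = {u. \<forall>j\<in>J. g j u \<ge> 0}"
    and Gint_nonempty: "Gint \<noteq> {}"
    and convex_G: "convex G"
    and regular: "\<forall>j\<in>J. \<exists>N. open N \<and> G \<subseteq> N \<and> C2_on (g j) N \<and> concave_within N (g j)"
    and mu_pos: "\<mu> > 0"
begin

lemma Gint_subset_G: "Gint \<subseteq> G"
  by (simp add: G_closure closure_subset)

lemma g_pos: "j \<in> J \<Longrightarrow> u \<in> Gint \<Longrightarrow> g j u > 0"
  by (simp add: Gint_eq)

lemma g_GDERIV: "j \<in> J \<Longrightarrow> u \<in> G \<Longrightarrow> GDERIV (g j) u :> gradient (g j) u"
  using regular C2_on_GDERIV by blast

lemma g_isCont: "j \<in> J \<Longrightarrow> u \<in> G \<Longrightarrow> isCont (g j) u"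
  using g_GDERIV has_derivative_continuous unfolding gderiv_def by blast

lemma g_concave: "j \<in> J \<Longrightarrow> concave_on G (g j)"
  using regular convex_G unfolding concave_within_def by blast

lemma gradient_g_C1:
  assumes "j \<in> J"
  shows "C1_on (gradient (g j)) G"
proof -
  obtain N where "open N" "G \<subseteq> N" "C2_on (g j) N"
    using regular assms by blast
  then show ?thesis
    using C2_on_gradient_C1[of "g j" N] unfolding C1_on_def
    by (meson continuous_on_subset subsetD)
qed


lemma open_Gint: "open Gint"
proof (subst open_subopen, intro ballI)
  fix u assume u: "u \<in> Gint"
  have "eventually (\<lambda>v. g j v > 0) (nhds u)" if "j \<in> J" for j
    using order_tendstoD(1)[of "g j" "g j u" "nhds u" 0] g_isCont[OF that] g_pos[OF that u]
      Gint_subset_G u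
    by (auto simp: isCont_def tendsto_at_iff_tendsto_nhds)
  then have "eventually (\<lambda>v. \<forall>j\<in>J. g j v > 0) (nhds u)"
    using finite_J by (simp add: eventually_ball_finite)
  then show "\<exists>T. open T \<and> u \<in> T \<and> T \<subseteq> Gint"
    unfolding Gint_eq eventually_nhds by blast
qed

lemma Phi_GDERIV_formula:
  assumes u: "u \<in> Gint"
  shows "GDERIV (Phi \<mu> J g) u :> u - \<mu> *\<^sub>R (\<Sum>j\<in>J. gradient (g j) u /\<^sub>R g j u)"
proof -
  have "((\<lambda>v. ln (g j v)) has_derivative (\<lambda>h. h \<bullet> (gradient (g j) u /\<^sub>R g j u))) (at u)"
    if j: "j \<in> J" for j
  proof -
    have "((\<lambda>v. g j v) has_derivative (\<lambda>h. h \<bullet> gradient (g j) u)) (at u)"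
      using g_GDERIV[OF j] Gint_subset_G u unfolding gderiv_def by blast
    then have "((\<lambda>v. ln (g j v)) has_derivative
        (\<lambda>h. (h \<bullet> gradient (g j) u) * inverse (g j u))) (at u)"
      by (rule has_derivative_ln[where g = "g j", OF g_pos[OF j u]])
    then show ?thesis
      by (simp add: mult.commute)
  qed
  then have "((\<lambda>v. (1/2) * (v \<bullet> v) - \<mu> * (\<Sum>j\<in>J. ln (g j v))) has_derivative
      (\<lambda>h. (1/2) * (u \<bullet> h + h \<bullet> u) - \<mu> * (\<Sum>j\<in>J. h \<bullet> (gradient (g j) u /\<^sub>R g j u)))) (at u)"
    by (intro has_derivative_diff has_derivative_mult_right has_derivative_sum
        has_derivative_inner has_derivative_ident)
  moreover have "(\<lambda>h. (1/2) * (u \<bullet> h + h \<bullet> u) - \<mu> * (\<Sum>j\<in>J. h \<bullet> (gradient (g j) u /\<^sub>R g j u)))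
      = (\<lambda>h. h \<bullet> (u - \<mu> *\<^sub>R (\<Sum>j\<in>J. gradient (g j) u /\<^sub>R g j u)))"
    by (simp only: inner_diff_right inner_scaleR_right inner_sum_right inner_commute[of u])
      simp
  ultimately show ?thesis
    unfolding gderiv_def Phi_def[abs_def] by (simp only: power2_norm_eq_inner)
qed

lemma Psi_formula:
  "u \<in> Gint \<Longrightarrow> Psi \<mu> J g u = u - \<mu> *\<^sub>R (\<Sum>j\<in>J. gradient (g j) u /\<^sub>R g j u)"
  unfolding Psi_def by (intro gradient_eqI Phi_GDERIV_formula)

lemma Phi_GDERIV: "u \<in> Gint \<Longrightarrow> GDERIV (Phi \<mu> J g) u :> Psi \<mu> J g u"
  using Phi_GDERIV_formula Psi_formula by simp

lemma Psi_C1: "C1_on (Psi \<mu> J g) Gint"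
proof -
  have "\<exists>H. (\<forall>x\<in>G. (gradient (g j) has_derivative blinfun_apply (H x)) (at x)) \<and> continuous_on G H"
    if "j \<in> J" for j
    using gradient_g_C1[OF that] unfolding C1_on_def by blast
  then obtain H where H: "\<And>j x. j \<in> J \<Longrightarrow> x \<in> G \<Longrightarrow>
      (gradient (g j) has_derivative blinfun_apply (H j x)) (at x)"
    "\<And>j. j \<in> J \<Longrightarrow> continuous_on G (H j)"
    by metis
  define P where "P u h = h - \<mu> *\<^sub>R (\<Sum>j\<in>J. inverse (g j u) *\<^sub>R H j u h
      + (- (inverse (g j u) * (h \<bullet> gradient (g j) u) * inverse (g j u))) *\<^sub>R gradient (g j) u)" for u h
  show ?thesis
  proof (rule C1_onI)
    fix u assume u: "u \<in> Gint"
    then have uG: "u \<in> G"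
      using Gint_subset_G by blast
    have "((\<lambda>v. v - \<mu> *\<^sub>R (\<Sum>j\<in>J. gradient (g j) v /\<^sub>R g j v)) has_derivative P u) (at u)"
      unfolding P_def
    proof (intro has_derivative_diff has_derivative_ident has_derivative_scaleR_right
        has_derivative_sum has_derivative_scaleR Deriv.has_derivative_inverse)
      fix j assume j: "j \<in> J"
      show "g j u \<noteq> 0"
        using g_pos[OF j u] by simp
      show "(g j has_derivative (\<lambda>h. h \<bullet> gradient (g j) u)) (at u)"
        using g_GDERIV[OF j uG] by (simp add: gderiv_def)
      show "(gradient (g j) has_derivative blinfun_apply (H j u)) (at u)"
        using H(1)[OF j uG] .
    qed
    then show "(Psi \<mu> J g has_derivative P u) (at u)"
      by (rule has_derivative_transform_within_open[OF _ open_Gint u]) (simp add: Psi_formula)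
  next
    fix h
    have "continuous_on Gint (g j)" if "j \<in> J" for j
      using g_isCont[OF that] Gint_subset_G by (blast intro: continuous_at_imp_continuous_on)
    moreover have "continuous_on Gint (gradient (g j))" if "j \<in> J" for j
      using C1_on_imp_continuous_on[OF gradient_g_C1[OF that]] Gint_subset_G
      by (rule continuous_on_subset)
    moreover have "continuous_on Gint (H j)" if "j \<in> J" for j
      using H(2)[OF that] Gint_subset_G by (rule continuous_on_subset)
    moreover have "\<forall>u\<in>Gint. g j u \<noteq> 0" if "j \<in> J" for j
      using g_pos[OF that] by force
    ultimately show "continuous_on Gint (\<lambda>u. P u h)"
      unfolding P_def by (intro continuous_intros) auto
  qed
qed

text \<open>With a and b the values of \<open>g\<^sub>j\<close> at u and v, both \<open>log (b/a) \<le> b/a - 1\<close> and the tangent bound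
  \<open>b - a \<le> \<nabla>g\<^sub>j(u) \<bullet> (v - u)\<close> estimate an increment from above, so together they give
  \<open>log b - log a \<le> \<nabla>g\<^sub>j(u) \<bullet> (v - u) / a\<close>. The quadratic term is its own second order Taylor
  polynomial.\<close>

lemma Phi_strongly_convex:
  assumes u: "u \<in> Gint" and v: "v \<in> Gint"
  shows "Phi \<mu> J g u + Psi \<mu> J g u \<bullet> (v - u) + (1/2) * (norm (v - u))\<^sup>2 \<le> Phi \<mu> J g v"
proof -
  have "ln (g j v) \<le> ln (g j u) + (gradient (g j) u /\<^sub>R g j u) \<bullet> (v - u)" if j: "j \<in> J" for j
  proof -
    have a: "g j u > 0" and b: "g j v > 0"
      using g_pos[OF j] u v by auto
    have "g j v \<le> g j u + gradient (g j) u \<bullet> (v - u)"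
      using concave_on_tangent[OF g_concave[OF j]] g_GDERIV[OF j] Gint_subset_G u v by blast
    then have "(g j v - g j u) / g j u \<le> (gradient (g j) u \<bullet> (v - u)) / g j u"
      using a by (intro divide_right_mono) auto
    moreover have "(g j v - g j u) / g j u = g j v / g j u - 1"
      using a by (simp add: diff_divide_distrib)
    moreover have "(gradient (g j) u \<bullet> (v - u)) / g j u = (gradient (g j) u /\<^sub>R g j u) \<bullet> (v - u)"
      by (simp only: inner_scaleR_left divide_inverse mult.commute)
    moreover have "ln (g j v / g j u) \<le> g j v / g j u - 1"
      using a b by (intro ln_le_minus_one) simp
    moreover have "ln (g j v / g j u) = ln (g j v) - ln (g j u)"
      using a b by (simp add: ln_div)
    ultimately show ?thesis
      by linarith
  qed
  then have "(\<Sum>j\<in>J. ln (g j v)) \<le> (\<Sum>j\<in>J. ln (g j u) + (gradient (g j) u /\<^sub>R g j u) \<bullet> (v - u))"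
    by (rule sum_mono)
  then have "\<mu> * (\<Sum>j\<in>J. ln (g j v)) \<le>
      \<mu> * ((\<Sum>j\<in>J. ln (g j u)) + (\<Sum>j\<in>J. gradient (g j) u /\<^sub>R g j u) \<bullet> (v - u))"
    using mu_pos by (simp add: sum.distrib inner_sum_left)
  moreover have "(1/2) * (norm v)\<^sup>2 = (1/2) * (norm u)\<^sup>2 + u \<bullet> (v - u) + (1/2) * (norm (v - u))\<^sup>2"
    by (simp add: power2_norm_eq_inner inner_diff inner_commute algebra_simps)
  ultimately show ?thesis
    unfolding Psi_formula[OF u] Phi_def inner_diff_left inner_scaleR_left
    by (simp only: distrib_left)
qed

lemma Psi_strongly_monotone: "strongly_monotone_on Gint (Psi \<mu> J g)"
  unfolding strongly_monotone_on_def
proof (intro ballI)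
  fix u v assume "u \<in> Gint" "v \<in> Gint"
  then have "Psi \<mu> J g u \<bullet> (v - u) + Psi \<mu> J g v \<bullet> (u - v) + (norm (u - v))\<^sup>2 \<le> 0"
    using Phi_strongly_convex[of u v] Phi_strongly_convex[of v u] norm_minus_commute[of u v]
    by simp
  then show "(norm (u - v))\<^sup>2 \<le> (Psi \<mu> J g u - Psi \<mu> J g v) \<bullet> (u - v)"
    by (simp add: inner_diff algebra_simps)
qed

text \<open>The sublevel set of the tilted potential at an arbitrary feasible point u0 lies in a compact subset
  K of the open set: strong convexity at u0 confines it to a ball of radius R, and there the bound on
  the sum of logarithms bounds every \<open>g\<^sub>j\<close> from below. The set K is closed because it is cut out of
  the closed set G by non-strict inequalities.\<close>

lemma tilted_Phi_attains_minimum: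
  "\<exists>v\<in>Gint. \<forall>u\<in>Gint. Phi \<mu> J g v - w \<bullet> v \<le> Phi \<mu> J g u - w \<bullet> u"
proof -
  define F where "F u = Phi \<mu> J g u - w \<bullet> u" for u
  obtain u0 where u0: "u0 \<in> Gint"
    using Gint_nonempty by blast
  \<comment> \<open>Strong convexity at u0 gives |u - u0| / 2 \<le> |\<Psi>(u0) - w| on the sublevel set.\<close>
  define R where "R = 2 * norm (Psi \<mu> J g u0 - w)"
  \<comment> \<open>The tangent of g j at u0 bounds g j from above on the ball.\<close>
  define M where "M j = g j u0 + norm (gradient (g j) u0) * R + 1" for j
  \<comment> \<open>On the sublevel set the sum of all ln (g j u) is at least L.\<close>
  define L where "L = - (F u0 + norm w * (norm u0 + R)) / \<mu>"
  \<comment> \<open>Bounding all logarithms but one from above by ln (M i) leaves ln (g j u) \<ge> ln (\<delta> j).\<close>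
  define \<delta> where "\<delta> j = exp (L - (\<Sum>i\<in>J - {j}. ln (M i)))" for j
  define K where "K = {u \<in> G. dist u0 u \<le> R \<and> (\<forall>j\<in>J. \<delta> j \<le> g j u)}"
  have R0: "R \<ge> 0" by (simp add: R_def)
  have M: "ln (g j u) \<le> ln (M j)" if j: "j \<in> J" and u: "u \<in> Gint" "norm (u - u0) \<le> R" for j u
  proof -
    have "g j u \<le> g j u0 + gradient (g j) u0 \<bullet> (u - u0)"
      using concave_on_tangent[OF g_concave[OF j]] g_GDERIV[OF j] Gint_subset_G u u0 by blast
    also have "\<dots> \<le> g j u0 + norm (gradient (g j) u0) * R"
      using norm_cauchy_schwarz[of "gradient (g j) u0" "u - u0"]
        mult_left_mono[OF u(2) norm_ge_zero[of "gradient (g j) u0"]] by linarith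
    finally have "g j u \<le> M j"
      by (simp add: M_def)
    then show ?thesis
      using g_pos[OF j u(1)] by simp
  qed
  have sub: "u \<in> K" if u: "u \<in> Gint" "F u \<le> F u0" for u
  proof -
    have "(Psi \<mu> J g u0 - w) \<bullet> (u - u0) + (1/2) * (norm (u - u0))\<^sup>2 \<le> 0"
      using Phi_strongly_convex[OF u0 u(1)] u(2) by (simp add: F_def inner_diff algebra_simps)
    moreover have "- (norm (Psi \<mu> J g u0 - w) * norm (u - u0)) \<le> (Psi \<mu> J g u0 - w) \<bullet> (u - u0)"
      using Cauchy_Schwarz_ineq2[of "Psi \<mu> J g u0 - w" "u - u0"] by linarith
    ultimately have "norm (u - u0) * norm (u - u0) \<le> R * norm (u - u0)"
      by (simp add: R_def power2_eq_square)
    then have n: "norm (u - u0) \<le> R"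
      using R0 by (metis mult_right_le_imp_le norm_ge_zero order_le_less)
    have "w \<bullet> u \<le> norm w * (norm u0 + R)"
    proof -
      have "norm u \<le> norm u0 + R"
        using n norm_triangle_sub[of u u0] by linarith
      then show ?thesis
        using norm_cauchy_schwarz[of w u] mult_left_mono[of "norm u" "norm u0 + R" "norm w"]
        by force
    qed
    then have "- \<mu> * (\<Sum>j\<in>J. ln (g j u)) \<le> F u0 + norm w * (norm u0 + R)"
      using u(2) zero_le_power2[of "norm u"] unfolding F_def Phi_def[of _ _ _ u] by linarith
    then have L: "L \<le> (\<Sum>j\<in>J. ln (g j u))"
      using mu_pos by (simp add: L_def field_simps)
    have "\<delta> j \<le> g j u" if j: "j \<in> J" for j
    proof -
      have "(\<Sum>i\<in>J. ln (g i u)) = ln (g j u) + (\<Sum>i\<in>J - {j}. ln (g i u))"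
        using finite_J j by (rule sum.remove)
      moreover have "(\<Sum>i\<in>J - {j}. ln (g i u)) \<le> (\<Sum>i\<in>J - {j}. ln (M i))"
        using M u(1) n by (intro sum_mono) auto
      ultimately have "L - (\<Sum>i\<in>J - {j}. ln (M i)) \<le> ln (g j u)"
        using L by linarith
      then show ?thesis
        using g_pos[OF j u(1)] by (metis \<delta>_def exp_le_cancel_iff exp_ln)
    qed
    then show ?thesis
      using u(1) n Gint_subset_G by (auto simp: K_def dist_norm norm_minus_commute)
  qed
  have KG: "K \<subseteq> Gint"
  proof
    fix u assume "u \<in> K"
    then have "\<delta> j \<le> g j u" if "j \<in> J" for j
      using that by (simp add: K_def)
    moreover have "\<delta> j > 0" for j
      by (simp add: \<delta>_def)
    ultimately show "u \<in> Gint"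
      unfolding Gint_eq by (auto intro: less_le_trans)
  qed
  have "closed K"
  proof -
    have clG: "closed G"
      by (simp add: G_closure)
    have "closed {u \<in> G. \<delta> j \<le> g j u}" if "j \<in> J" for j
    proof -
      have "continuous_on G (g j)"
        using g_isCont[OF that] by (blast intro: continuous_at_imp_continuous_on)
      then have "closed (G \<inter> g j -` {\<delta> j..})"
        using clG closed_atLeast by (rule continuous_closed_preimage)
      moreover have "G \<inter> g j -` {\<delta> j..} = {u \<in> G. \<delta> j \<le> g j u}"
        by auto
      ultimately show ?thesis by simp
    qed
    then have "closed (\<Inter>j\<in>J. {u \<in> G. \<delta> j \<le> g j u})"
      by blast
    moreover have "K = G \<inter> cball u0 R \<inter> (\<Inter>j\<in>J. {u \<in> G. \<delta> j \<le> g j u})"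
      by (auto simp: K_def)
    ultimately show ?thesis
      using clG by (simp add: closed_Int)
  qed
  moreover have "K \<subseteq> cball u0 R"
    by (auto simp: K_def)
  ultimately have "compact K"
    using bounded_subset bounded_cball compact_eq_bounded_closed by blast
  moreover have "u0 \<in> K"
    using sub u0 by simp
  moreover have "continuous_on K F"
  proof -
    have "isCont (Phi \<mu> J g) u" if "u \<in> K" for u
      using Phi_GDERIV has_derivative_continuous KG that unfolding gderiv_def by blast
    then have "continuous_on K (Phi \<mu> J g)"
      by (blast intro: continuous_at_imp_continuous_on)
    then show ?thesis
      unfolding F_def by (intro continuous_intros)
  qed
  ultimately obtain v where v: "v \<in> K" "\<And>u. u \<in> K \<Longrightarrow> F v \<le> F u"
    using continuous_attains_inf[of K F] by blast
  have "F v \<le> F u" if "u \<in> Gint" for u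
    using v(2)[OF \<open>u0 \<in> K\<close>] v(2)[OF sub[OF that]] by linarith
  then show ?thesis
    using v(1) KG by (auto simp: F_def)
qed

text \<open>A minimizer over an open set is a critical point, and strong convexity gives the converse.\<close>

lemma minimum_tilted_Phi_iff:
  assumes v: "v \<in> Gint"
  shows "(\<forall>u\<in>Gint. Phi \<mu> J g v - w \<bullet> v \<le> Phi \<mu> J g u - w \<bullet> u) \<longleftrightarrow> Psi \<mu> J g v = w"
proof
  assume min: "\<forall>u\<in>Gint. Phi \<mu> J g v - w \<bullet> v \<le> Phi \<mu> J g u - w \<bullet> u"
  have "((\<lambda>u. w \<bullet> u) has_derivative (\<lambda>h. w \<bullet> h)) (at v)"
    by (intro has_derivative_inner_right has_derivative_ident)
  from has_derivative_diff[OF Phi_GDERIV[OF v, unfolded gderiv_def] this]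
  have "(\<lambda>h. h \<bullet> Psi \<mu> J g v - w \<bullet> h) = (\<lambda>h. 0)"
    by (rule differential_zero_maxmin[OF v open_Gint]) (use min in blast)
  then have "h \<bullet> (Psi \<mu> J g v - w) = 0" for h
    by (metis inner_commute inner_diff_right)
  then show "Psi \<mu> J g v = w"
    by (metis inner_eq_zero_iff right_minus_eq)
next
  assume crit: "Psi \<mu> J g v = w"
  show "\<forall>u\<in>Gint. Phi \<mu> J g v - w \<bullet> v \<le> Phi \<mu> J g u - w \<bullet> u"
  proof
    fix u assume "u \<in> Gint"
    then have "Phi \<mu> J g v + w \<bullet> (u - v) + (1/2) * (norm (u - v))\<^sup>2 \<le> Phi \<mu> J g u"
      using Phi_strongly_convex[OF v] crit by simp
    then show "Phi \<mu> J g v - w \<bullet> v \<le> Phi \<mu> J g u - w \<bullet> u"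
      using zero_le_power2[of "norm (u - v)"] unfolding inner_diff_right by linarith
  qed
qed

lemma Psi_bij: "bij_betw (Psi \<mu> J g) Gint UNIV"
  unfolding bij_betw_def
proof
  show "inj_on (Psi \<mu> J g) Gint"
    using Psi_strongly_monotone by (rule strongly_monotone_on_inj)
  have "w \<in> Psi \<mu> J g ` Gint" for w
    using tilted_Phi_attains_minimum[of w] minimum_tilted_Phi_iff[of _ w] by auto
  then show "Psi \<mu> J g ` Gint = UNIV"
    by blast
qed

lemma is_arg_min_tilted_Phi_iff:
  "is_arg_min (\<lambda>u. Phi \<mu> J g u - w \<bullet> u) (\<lambda>u. u \<in> Gint) v \<longleftrightarrow> v = inv_into Gint (Psi \<mu> J g) w"
proof -
  have "is_arg_min (\<lambda>u. Phi \<mu> J g u - w \<bullet> u) (\<lambda>u. u \<in> Gint) v \<longleftrightarrow>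
      v \<in> Gint \<and> Psi \<mu> J g v = w"
    using minimum_tilted_Phi_iff[of v w] unfolding is_arg_min_linorder by blast
  also have "\<dots> \<longleftrightarrow> v = inv_into Gint (Psi \<mu> J g) w"
    using Psi_bij by (metis UNIV_I bij_betw_def f_inv_into_f inv_into_f_f inv_into_into)
  finally show ?thesis .
qed

lemma Psi_has_derivative_jacobian:
  assumes "u \<in> Gint"
  shows "(Psi \<mu> J g has_derivative (\<lambda>h. jacobian (Psi \<mu> J g) (at u) *v h)) (at u)"
  using C1_on_differentiable[OF Psi_C1 assms] by (simp add: jacobian_works)

lemma transpose_jacobian_Psi:
  assumes u: "u \<in> Gint"
  shows "transpose (jacobian (Psi \<mu> J g) (at u)) = jacobian (Psi \<mu> J g) (at u)"
proof -
  have "jacobian (Psi \<mu> J g) (at u) $ i $ j = jacobian (Psi \<mu> J g) (at u) $ j $ i" for i j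
    using GDERIV_differentiable_imp_symmetric[OF open_Gint u Phi_GDERIV
        Psi_has_derivative_jacobian[OF u], of "axis j 1" "axis i 1"]
    by (simp add: inner_axis matrix_vector_mult_basis column_def)
  then show ?thesis
    by (simp add: transpose_def vec_eq_iff)
qed

text \<open>The Hessian differentiates the j-th component of the gradient in direction i, so as a matrix it is
  the transpose of the Jacobian of the gradient; symmetry removes the difference. The identity of
  \<open>partial_derivative j \<Phi>\<close> with a component of \<Psi> holds on the open set only, which is enough to
  differentiate it once more.\<close>

lemma hessian_Phi:
  assumes u: "u \<in> Gint"
  shows "hessian (Phi \<mu> J g) u = jacobian (Psi \<mu> J g) (at u)"
proof -
  have "hessian (Phi \<mu> J g) u $ i $ j = jacobian (Psi \<mu> J g) (at u) $ j $ i" for i j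
  proof -
    have first: "partial_derivative j (Phi \<mu> J g) v = Psi \<mu> J g v $ j" if "v \<in> Gint" for v
      using partial_derivative_eq[OF Phi_GDERIV[OF that, unfolded gderiv_def], of j]
      by (simp add: inner_axis')
    have "((\<lambda>v. Psi \<mu> J g v $ j) has_derivative
        (\<lambda>h. (jacobian (Psi \<mu> J g) (at u) *v h) $ j)) (at u)"
      using Psi_has_derivative_jacobian[OF u]
      by (rule bounded_linear.has_derivative[OF bounded_linear_vec_nth])
    then have "(partial_derivative j (Phi \<mu> J g) has_derivative
        (\<lambda>h. (jacobian (Psi \<mu> J g) (at u) *v h) $ j)) (at u)"
      by (rule has_derivative_transform_within_open[OF _ open_Gint u]) (simp add: first)
    then show ?thesis
      by (simp add: hessian_def partial_derivative_eq matrix_vector_mult_basis column_def)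
  qed
  then have "hessian (Phi \<mu> J g) u = transpose (jacobian (Psi \<mu> J g) (at u))"
    by (simp add: vec_eq_iff transpose_def)
  then show ?thesis
    using transpose_jacobian_Psi[OF u] by simp
qed

lemma jacobian_Psi_spd:
  assumes u: "u \<in> Gint"
  shows "symmetric_positive_definite (jacobian (Psi \<mu> J g) (at u))"
  unfolding symmetric_positive_definite_def
proof (intro conjI allI impI transpose_jacobian_Psi[OF u])
  fix v :: "real ^ 'm" assume "v \<noteq> 0"
  then have "0 < (norm v)\<^sup>2" by simp
  also have "\<dots> \<le> v \<bullet> (jacobian (Psi \<mu> J g) (at u) *v v)"
    using strongly_monotone_on_derivative[OF Psi_strongly_monotone open_Gint u
        Psi_has_derivative_jacobian[OF u]] by (simp add: inner_commute)
  finally show "0 < v \<bullet> (jacobian (Psi \<mu> J g) (at u) *v v)" .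
qed

end

section \<open>Conservation laws under a change of variables\<close>

text \<open>With D the Jacobian of F at u, the spatial derivatives of w = F(u) are D applied to those of u,
  and the factor \<open>D\<^sup>-\<^sup>1\<close> in the transformed flux matrix cancels this D. The whole left hand side is
  then D applied to the equation for u.\<close>

lemma conservation_law_change_of_variables:
  fixes F :: "real ^ 'm \<Rightarrow> real ^ 'm" and f :: "'d::finite \<Rightarrow> real ^ 'm \<Rightarrow> real ^ 'm"
    and u :: "(real ^ 'd) \<times> real \<Rightarrow> real ^ 'm"
  assumes u: "(u has_derivative u') (at (x, t))"
    and F: "F differentiable at (u (x, t))"
    and f: "\<And>i. f i differentiable at (u (x, t))"
    and inv: "invertible (jacobian F (at (u (x, t))))"
    and eq: "dt u x t + (\<Sum>i\<in>UNIV. dx i (\<lambda>p. f i (u p)) x t) = 0"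
  shows "dt (\<lambda>p. F (u p)) x t
     + (\<Sum>i\<in>UNIV. (jacobian F (at (u (x, t))) ** jacobian (f i) (at (u (x, t)))
          ** matrix_inv (jacobian F (at (u (x, t))))) *v dx i (\<lambda>p. F (u p)) x t) = 0"
proof -
  define D where "D = jacobian F (at (u (x, t)))"
  define A where "A i = jacobian (f i) (at (u (x, t)))" for i
  have w: "((\<lambda>p. F (u p)) has_derivative (\<lambda>h. D *v u' h)) (at (x, t))"
    using has_derivative_compose[OF u F[unfolded jacobian_works]] by (simp add: D_def)
  have fu: "((\<lambda>p. f i (u p)) has_derivative (\<lambda>h. A i *v u' h)) (at (x, t))" for i
    using has_derivative_compose[OF u f[unfolded jacobian_works]] by (simp add: A_def)
  have "matrix_inv D ** D = mat 1"
    using someI_ex[OF inv[unfolded invertible_def]] unfolding D_def matrix_inv_def by blast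
  then have cancel: "matrix_inv D *v (D *v y) = y" for y
    by (simp add: matrix_vector_mul_assoc)
  have "dt (\<lambda>p. F (u p)) x t
      + (\<Sum>i\<in>UNIV. (D ** A i ** matrix_inv D) *v dx i (\<lambda>p. F (u p)) x t)
    = D *v u' (0, 1) + (\<Sum>i\<in>UNIV. D *v (A i *v u' (axis i 1, 0)))"
    by (simp add: dt_eq[OF w] dx_eq[OF w] cancel flip: matrix_vector_mul_assoc)
  also have "\<dots> = D *v (dt u x t + (\<Sum>i\<in>UNIV. dx i (\<lambda>p. f i (u p)) x t))"
    by (simp add: dt_eq[OF u] dx_eq[OF fu] matrix_vector_right_distrib
        linear_sum[OF matrix_vector_mul_linear, of D])
  finally show ?thesis
    using eq by (simp add: D_def A_def)
qed

lemma symmetric_positive_definite_invertible: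
  assumes "symmetric_positive_definite A"
  shows "invertible A"
  using assms unfolding symmetric_positive_definite_def invertible_left_inverse
    matrix_left_invertible_ker
  by (metis inner_zero_right less_irrefl)

theorem theoremA1:
  fixes J :: "'j set"
    and g :: "'j \<Rightarrow> real ^ 'm \<Rightarrow> real"
    and Gint G :: "(real ^ 'm) set"
    and \<mu> :: real
  assumes "finite J"
    and "Gint = {u. \<forall>j\<in>J. g j u > 0}"
    and "G = closure Gint"
    and "G = {u. \<forall>j\<in>J. g j u \<ge> 0}"
    and "Gint \<noteq> {}"
    and "convex G"
    and "\<forall>j\<in>J. \<exists>N. open N \<and> G \<subseteq> N \<and> C2_on (g j) N \<and> concave_within N (g j)"
    and "\<mu> > 0"
  shows
    "(\<forall>u\<in>Gint. GDERIV (Phi \<mu> J g) u :> Psi \<mu> J g u \<and>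
        Psi \<mu> J g u = u - \<mu> *\<^sub>R (\<Sum>j\<in>J. gradient (g j) u /\<^sub>R g j u))
     \<and>
     (bij_betw (Psi \<mu> J g) Gint UNIV \<and>
      (\<forall>w v. is_arg_min (\<lambda>u. Phi \<mu> J g u - w \<bullet> u) (\<lambda>u. u \<in> Gint) v
             \<longleftrightarrow> v = inv_into Gint (Psi \<mu> J g) w))
     \<and>
     (C1_on (Psi \<mu> J g) Gint \<and>
      (\<forall>u\<in>Gint. jacobian (Psi \<mu> J g) (at u) = hessian (Phi \<mu> J g) u \<and>
                symmetric_positive_definite (jacobian (Psi \<mu> J g) (at u))) \<and>
      C1_diffeomorphism (Psi \<mu> J g) Gint UNIV \<and>
      (\<forall>w1 w2. norm (inv_into Gint (Psi \<mu> J g) w1 - inv_into Gint (Psi \<mu> J g) w2)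
               \<le> norm (w1 - w2)))
     \<and>
     (\<forall>(f :: 'd::finite \<Rightarrow> real ^ 'm \<Rightarrow> real ^ 'm) (\<Omega> :: ((real ^ 'd) \<times> real) set)
        (u :: (real ^ 'd) \<times> real \<Rightarrow> real ^ 'm).
        (\<forall>i. C1_on (f i) Gint) \<and>
        open \<Omega> \<and> C1_on u \<Omega> \<and> u ` \<Omega> \<subseteq> Gint \<and>
        (\<forall>(x, t)\<in>\<Omega>. dt u x t + (\<Sum>i\<in>UNIV. dx i (\<lambda>p. f i (u p)) x t) = 0)
        \<longrightarrow>
        (let w = (\<lambda>p. Psi \<mu> J g (u p));
             A = (\<lambda>i v. jacobian (f i) (at v));
             D = (\<lambda>v. jacobian (Psi \<mu> J g) (at v))
         in C1_on w \<Omega> \<and>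
            (\<forall>(x, t)\<in>\<Omega>.
               dt w x t
               + (\<Sum>i\<in>UNIV. (D (u (x, t)) ** A i (u (x, t)) ** matrix_inv (D (u (x, t))))
                              *v dx i w x t) = 0)))"
proof -
  interpret log_barrier J g Gint G \<mu>
    by unfold_locales (fact assms)+
  have onto: "Psi \<mu> J g ` Gint = UNIV"
    using Psi_bij by (simp add: bij_betw_def)
  have pde: "let w = (\<lambda>p. Psi \<mu> J g (u p));
             A = (\<lambda>i v. jacobian (f i) (at v));
             D = (\<lambda>v. jacobian (Psi \<mu> J g) (at v))
         in C1_on w \<Omega> \<and>
            (\<forall>(x, t)\<in>\<Omega>.
               dt w x t
               + (\<Sum>i\<in>UNIV. (D (u (x, t)) ** A i (u (x, t)) ** matrix_inv (D (u (x, t))))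
                              *v dx i w x t) = 0)"
    if f: "\<forall>i. C1_on (f i) Gint" and u: "C1_on u \<Omega>" "u ` \<Omega> \<subseteq> Gint"
      and eq: "\<forall>(x, t)\<in>\<Omega>. dt u x t + (\<Sum>i\<in>UNIV. dx i (\<lambda>p. f i (u p)) x t) = 0"
    for f :: "'d::finite \<Rightarrow> real ^ 'm \<Rightarrow> real ^ 'm" and \<Omega> :: "((real ^ 'd) \<times> real) set"
      and u :: "(real ^ 'd) \<times> real \<Rightarrow> real ^ 'm"
    unfolding Let_def
  proof (intro conjI ballI)
    show "C1_on (\<lambda>p. Psi \<mu> J g (u p)) \<Omega>"
      using C1_on_compose[OF u(1) Psi_C1 u(2)] .
    fix p assume "p \<in> \<Omega>"
    moreover obtain x t where p: "p = (x, t)"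
      by (cases p)
    ultimately have xt: "(x, t) \<in> \<Omega>" and uxt: "u (x, t) \<in> Gint"
      using u(2) by auto
    obtain u' where "(u has_derivative u') (at (x, t))"
      using C1_on_differentiable[OF u(1) xt] unfolding differentiable_def by blast
    then show "case p of (x, t) \<Rightarrow> dt (\<lambda>p. Psi \<mu> J g (u p)) x t
        + (\<Sum>i\<in>UNIV. (jacobian (Psi \<mu> J g) (at (u (x, t))) ** jacobian (f i) (at (u (x, t)))
            ** matrix_inv (jacobian (Psi \<mu> J g) (at (u (x, t))))) *v
              dx i (\<lambda>p. Psi \<mu> J g (u p)) x t) = 0"
      unfolding p prod.case
    proof (rule conservation_law_change_of_variables)
      show "Psi \<mu> J g differentiable at (u (x, t))"
        using C1_on_differentiable[OF Psi_C1 uxt] .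
      show "f i differentiable at (u (x, t))" for i
        using C1_on_differentiable[OF f[rule_format] uxt] .
      show "invertible (jacobian (Psi \<mu> J g) (at (u (x, t))))"
        using symmetric_positive_definite_invertible[OF jacobian_Psi_spd[OF uxt]] .
      show "dt u x t + (\<Sum>i\<in>UNIV. dx i (\<lambda>p. f i (u p)) x t) = 0"
        using eq xt by auto
    qed
  qed
  show ?thesis
  proof (intro conjI)
    show "\<forall>u\<in>Gint. GDERIV (Phi \<mu> J g) u :> Psi \<mu> J g u \<and>
        Psi \<mu> J g u = u - \<mu> *\<^sub>R (\<Sum>j\<in>J. gradient (g j) u /\<^sub>R g j u)"
      using Phi_GDERIV Psi_formula by blast
    show "\<forall>u\<in>Gint. jacobian (Psi \<mu> J g) (at u) = hessian (Phi \<mu> J g) u \<and>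
                symmetric_positive_definite (jacobian (Psi \<mu> J g) (at u))"
      using hessian_Phi jacobian_Psi_spd by simp
    show "C1_diffeomorphism (Psi \<mu> J g) Gint UNIV"
      using strongly_monotone_on_C1_diffeomorphism[OF Psi_strongly_monotone open_Gint onto _ Psi_C1]
      by simp
    show "\<forall>w1 w2. norm (inv_into Gint (Psi \<mu> J g) w1 - inv_into Gint (Psi \<mu> J g) w2)
               \<le> norm (w1 - w2)"
      using strongly_monotone_on_inverse_nonexpansive[OF Psi_strongly_monotone onto] by blast
  qed (use Psi_bij is_arg_min_tilted_Phi_iff Psi_C1 pde in blast)+
qed

end
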